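(* Let $\vartheta$ be a primitive random substitution with RS-subshift $X_\vartheta$. Then the set $\operatorname{Lin}(X_\vartheta)\subseteq X_\vartheta$ of linearly repetitive elements of $X_\vartheta$ is dense in $X_\vartheta$.
   Context: Let $\mathcal A=\{a_1,\dots,a_n\}$ be a finite alphabet, $\mathcal A^+$ the set of non-empty finite words over $\mathcal A$, and $\mathcal A^{\mathbb Z}$ the set of bi-infinite sequences with the product topology ($\mathcal A$ discrete). A random substitution (non-degenerate; the probabilities, all non-zero, play no role here and are suppressed) is a map $\vartheta$ assigning to each letter $a_i$ a non-empty finite set $\vartheta(a_i)\subset\mathcal A^+$ of realisations. A realisation of $\vartheta(u)$, for $u=u_1\cdots u_m\in\mathcal A^+$, is a word $x_1\cdots x_m$ with each $x_j\in\vartheta(u_j)$ chosen independently for each position. Realisations of $\vartheta^k(u)$ are defined inductively: $\vartheta^0$ is the identity, and the realisations of $\vartheta^{k+1}(u)$ are the realisations of $\vartheta(v)$ for $v$ a realisation of $\vartheta^k(u)$. $\vartheta$ is primitive if there is $k\in\mathbb N$ such that for all $1\le i,j\le n$ the letter $a_i$ is a subword of some realisation of $\vartheta^k(a_j)$. A word $u\in\mathcal A^+$ is $\vartheta$-legal if it is a subword of some realisation of $\vartheta^k(a_j)$ for some $k\in\mathbb N$ and some $j$. The RS-subshift is $X_\vartheta=\{w\in\mathcal A^{\mathbb Z}: \text{every finite non-empty subword of } w \text{ is } \vartheta\text{-legal}\}$. A sequence $w\in\mathcal A^{\mathbb Z}$ is linearly repetitive if there exists a real number $L\ge 1$ such that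 for all $m\ge 1$, every subword $u$ of $w$ of length $m$ is a subword of every subword $v$ of $w$ of length at least $Lm$. *)

theory Defs
  imports "HOL-Analysis.Analysis" "HOL-Library.Sublist"
begin

text \<open>
  The alphabet is a type of class \<open>finite\<close>. Words are lists; a \<^emph>\<open>subword\<close> is a contiguous
  factor, i.e. \<^const>\<open>sublist\<close> (not \<^const>\<open>subseq\<close>).
\<close>

definition random_substitution :: "('a \<Rightarrow> 'a list set) \<Rightarrow> bool" where
  "random_substitution \<theta> \<longleftrightarrow> (\<forall>a. finite (\<theta> a) \<and> \<theta> a \<noteq> {} \<and> [] \<notin> \<theta> a)"

text \<open>The list \<open>xs\<close> holds the realisations chosen at the individual positions of \<open>u\<close>, so
  two occurrences of the same letter may be substituted differently.\<close>

definition realisations :: "('a \<Rightarrow> 'a list set) \<Rightarrow> 'a list \<Rightarrow> 'a list set" where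
  "realisations \<theta> u = {concat xs | xs. list_all2 (\<lambda>x a. x \<in> \<theta> a) xs u}"

primrec realisations_pow :: "('a \<Rightarrow> 'a list set) \<Rightarrow> nat \<Rightarrow> 'a list \<Rightarrow> 'a list set" where
  "realisations_pow \<theta> 0 u = {u}"
| "realisations_pow \<theta> (Suc k) u = (\<Union>v\<in>realisations_pow \<theta> k u. realisations \<theta> v)"

definition primitive :: "('a \<Rightarrow> 'a list set) \<Rightarrow> bool" where
  "primitive \<theta> \<longleftrightarrow> (\<exists>k. \<forall>a b. \<exists>v\<in>realisations_pow \<theta> k [b]. sublist [a] v)"

definition legal :: "('a \<Rightarrow> 'a list set) \<Rightarrow> 'a list \<Rightarrow> bool" where
  "legal \<theta> u \<longleftrightarrow> u \<noteq> [] \<and> (\<exists>k b. \<exists>v\<in>realisations_pow \<theta> k [b]. sublist u v)"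

definition subword_of_seq :: "'a list \<Rightarrow> (int \<Rightarrow> 'a) \<Rightarrow> bool" where
  "subword_of_seq u w \<longleftrightarrow> (\<exists>i. u = map (\<lambda>j. w (i + int j)) [0..<length u])"

definition RS_subshift :: "('a \<Rightarrow> 'a list set) \<Rightarrow> (int \<Rightarrow> 'a) set" where
  "RS_subshift \<theta> = {w. \<forall>u. u \<noteq> [] \<and> subword_of_seq u w \<longrightarrow> legal \<theta> u}"

definition linearly_repetitive :: "(int \<Rightarrow> 'a) \<Rightarrow> bool" where
  "linearly_repetitive w \<longleftrightarrow>
    (\<exists>L::real. L \<ge> 1 \<and>
      (\<forall>m::nat. m \<ge> 1 \<longrightarrow>
        (\<forall>u v. subword_of_seq u w \<and> length u = m \<and>
               subword_of_seq v w \<and> real (length v) \<ge> L * real m \<longrightarrow> sublist u v)))"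

definition Lin :: "(int \<Rightarrow> 'a) set \<Rightarrow> (int \<Rightarrow> 'a) set" where
  "Lin X = {w \<in> X. linearly_repetitive w}"

definition full_shift :: "(int \<Rightarrow> 'a) topology" where
  "full_shift = product_topology (\<lambda>_. discrete_topology UNIV) UNIV"

end

theory Submission
  imports Defs
begin

text \<open>
  Let \<open>u\<close> be a central window of \<open>w \<in> X\<^sub>\<theta>\<close>. Since \<open>u\<close> is legal and \<open>\<theta>\<close> is primitive, for a
  suitable \<open>K\<close> one can choose for every letter \<open>b\<close> a realisation \<open>\<sigma> b\<close> of \<open>\<theta>\<^sup>K(b)\<close> that contains
  \<open>u\<close> and, away from its two ends, every letter. This \<open>\<sigma>\<close> is a deterministic primitive substitution.
  As \<open>a\<close> lies in the interior of \<open>\<sigma> a\<close>, the words \<open>\<sigma>\<^sup>n(a)\<close> grow in both directions to a bi-infinite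
  sequence of \<open>X\<^sub>\<theta>\<close> that contains \<open>u\<close> and is linearly repetitive by the classical argument
  for primitive substitutions. A shift of it agrees with \<open>w\<close> on the window.
\<close>

section \<open>Realisations of a random substitution\<close>

lemma realisations_append:
  assumes "x \<in> realisations \<theta> u" "y \<in> realisations \<theta> v"
  shows "x @ y \<in> realisations \<theta> (u @ v)"
proof -
  obtain xs ys where "x = concat xs" "list_all2 (\<lambda>x a. x \<in> \<theta> a) xs u"
    "y = concat ys" "list_all2 (\<lambda>x a. x \<in> \<theta> a) ys v"
    using assms unfolding realisations_def by blast
  then have "x @ y = concat (xs @ ys)" "list_all2 (\<lambda>x a. x \<in> \<theta> a) (xs @ ys) (u @ v)"
    by (auto intro: list_all2_appendI)
  then show ?thesis
    unfolding realisations_def by blast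
qed

lemma realisations_pow_append:
  assumes "x \<in> realisations_pow \<theta> k u" "y \<in> realisations_pow \<theta> k v"
  shows "x @ y \<in> realisations_pow \<theta> k (u @ v)"
  using assms by (induction k arbitrary: x y) (auto intro: realisations_append)

lemma realisations_pow_add:
  assumes "v \<in> realisations_pow \<theta> m u" "w \<in> realisations_pow \<theta> n v"
  shows "w \<in> realisations_pow \<theta> (m + n) u"
  using assms by (induction n arbitrary: w) auto

lemma realisations_pow_Nil: "[] \<in> realisations_pow \<theta> k []"
proof (induction k)
  case (Suc k)
  have "[] \<in> realisations \<theta> []"
    by (simp add: realisations_def)
  with Suc show ?case by auto
qed simp

lemma realisations_nonempty:
  assumes "random_substitution \<theta>"
  shows "realisations \<theta> u \<noteq> {}"
proof -
  have "\<exists>xs. list_all2 (\<lambda>x a. x \<in> \<theta> a) xs u"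
    using assms by (induction u) (auto simp: random_substitution_def list_all2_Cons2)
  then show ?thesis
    by (auto simp: realisations_def)
qed

lemma realisations_pow_nonempty:
  assumes "random_substitution \<theta>"
  shows "\<exists>v. v \<in> realisations_pow \<theta> k u"
proof (induction k)
  case (Suc k)
  then show ?case
    using realisations_nonempty[OF assms] by fastforce
qed simp

lemma Nil_in_realisationsD:
  assumes "random_substitution \<theta>" "[] \<in> realisations \<theta> u"
  shows "u = []"
  using assms by (cases u) (auto simp: realisations_def random_substitution_def list_all2_Cons2)

lemma Nil_in_realisations_powD:
  assumes "random_substitution \<theta>" "[] \<in> realisations_pow \<theta> k u"
  shows "u = []"
  using assms(2) by (induction k) (auto dest: Nil_in_realisationsD[OF assms(1)])

lemma realisations_pow_sublist:
  assumes "random_substitution \<theta>" "sublist u v" "x \<in> realisations_pow \<theta> k u"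
  shows "\<exists>y\<in>realisations_pow \<theta> k v. sublist x y"
proof -
  obtain p s where v: "v = p @ u @ s"
    using assms(2) by (auto simp: sublist_def)
  obtain p' s' where "p' \<in> realisations_pow \<theta> k p" "s' \<in> realisations_pow \<theta> k s"
    using realisations_pow_nonempty[OF assms(1)] by meson
  then have "p' @ x @ s' \<in> realisations_pow \<theta> k v"
    unfolding v using assms(3) by (intro realisations_pow_append)
  then show ?thesis
    by (meson sublist_appendI)
qed

section \<open>Words that occur, at one common level, in realisations of every letter\<close>

definition reachable :: "('a \<Rightarrow> 'a list set) \<Rightarrow> nat \<Rightarrow> 'a list \<Rightarrow> bool" where
  "reachable \<theta> k t \<longleftrightarrow> (\<forall>b. \<exists>v\<in>realisations_pow \<theta> k [b]. sublist t v)"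

text \<open>The \<open>j\<close> additional substitutions come first: whatever word they make of
  \<open>[b]\<close> is non-empty, and its first letter can yield \<open>t\<close> after
  \<open>k\<close> more.\<close>

lemma reachable_add:
  assumes rs: "random_substitution \<theta>" and t: "reachable \<theta> k t"
  shows "reachable \<theta> (j + k) t"
  unfolding reachable_def
proof
  fix b
  obtain x where x: "x \<in> realisations_pow \<theta> j [b]"
    using realisations_pow_nonempty[OF rs] by blast
  then obtain c cs where c: "x = c # cs"
    using Nil_in_realisations_powD[OF rs] by (cases x) auto
  obtain y where y: "y \<in> realisations_pow \<theta> k [c]" "sublist t y"
    using t by (auto simp: reachable_def)
  have "sublist [c] x"
    by (simp add: c prefix_imp_sublist)
  then obtain z where "z \<in> realisations_pow \<theta> k x" "sublist y z"
    using realisations_pow_sublist[OF rs _ y(1)] by blast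
  then show "\<exists>v\<in>realisations_pow \<theta> (j + k) [b]. sublist t v"
    using realisations_pow_add[OF x] y(2) sublist_order.order.trans by blast
qed

text \<open>From any letter, primitivity produces after \<open>k\<close> steps the letter
  \<open>c\<close> that witnesses the legality of \<open>t\<close>; \<open>j\<close> further steps
  can turn this \<open>c\<close> into a word containing \<open>t\<close>.\<close>

lemma legal_imp_reachable:
  assumes rs: "random_substitution \<theta>" and "primitive \<theta>" "legal \<theta> t"
  shows "\<exists>k. reachable \<theta> k t"
proof -
  obtain k j c v where k: "\<And>a. reachable \<theta> k [a]"
    and v: "v \<in> realisations_pow \<theta> j [c]" "sublist t v"
    using assms by (auto simp: reachable_def primitive_def legal_def)
  have "\<exists>y\<in>realisations_pow \<theta> (k + j) [b]. sublist t y" for b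
  proof -
    obtain x where x: "x \<in> realisations_pow \<theta> k [b]" "sublist [c] x"
      using k by (auto simp: reachable_def)
    obtain z where "z \<in> realisations_pow \<theta> j x" "sublist v z"
      using realisations_pow_sublist[OF rs x(2) v(1)] by blast
    then show ?thesis
      using realisations_pow_add[OF x(1)] v(2) sublist_order.order.trans by blast
  qed
  then show ?thesis
    unfolding reachable_def by blast
qed

text \<open>Positions of \<open>z\<close> are substituted independently, so each word of
  \<open>ts\<close> can be assigned a letter of \<open>z\<close> of its own.\<close>

lemma reachable_simultaneously:
  assumes rs: "random_substitution \<theta>"
    and "\<And>t. t \<in> set ts \<Longrightarrow> reachable \<theta> k t" "length ts \<le> length z"
  shows "\<exists>y\<in>realisations_pow \<theta> k z. \<forall>t\<in>set ts. sublist t y"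
  using assms(2,3)
proof (induction ts arbitrary: z)
  case Nil
  then show ?case
    using realisations_pow_nonempty[OF rs] by auto
next
  case (Cons t ts)
  then obtain b z' where z: "z = b # z'"
    by (cases z) auto
  obtain y where y: "y \<in> realisations_pow \<theta> k z'" "\<forall>t\<in>set ts. sublist t y"
    using Cons.IH[of z'] Cons.prems z by auto
  obtain x where x: "x \<in> realisations_pow \<theta> k [b]" "sublist t x"
    using Cons.prems(1)[of t] by (auto simp: reachable_def)
  have "x @ y \<in> realisations_pow \<theta> k z"
    using realisations_pow_append[OF x(1) y(1)] z by simp
  moreover have "\<forall>t\<in>set (t # ts). sublist t (x @ y)"
    using x(2) y(2) by (auto simp: sublist_append)
  ultimately show ?case by blast
qed

text \<open>The words \<open>x\<close> and \<open>z\<close> keep the letters of \<open>y\<close> away from the ends of the realisation, so that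
  iterating it around an occurrence of \<open>b\<close> in \<open>y\<close> extends it to both sides.\<close>

lemma realisation_with_all_letters:
  fixes \<theta> :: "'a::finite \<Rightarrow> 'a list set"
  assumes rs: "random_substitution \<theta>" and prim: "primitive \<theta>" and u: "legal \<theta> u"
    and long: "\<And>n. \<exists>v. legal \<theta> v \<and> length v = n + 1"
  shows "\<exists>k. \<forall>b. \<exists>x y z. x @ y @ z \<in> realisations_pow \<theta> k [b] \<and> x \<noteq> [] \<and> z \<noteq> [] \<and>
    set y = UNIV \<and> sublist u y"
proof -
  obtain k where k: "\<And>a. reachable \<theta> k [a]"
    using prim by (auto simp: reachable_def primitive_def)
  obtain l where l: "reachable \<theta> l u"
    using legal_imp_reachable[OF rs prim u] by blast
  define m where "m = l + k"
  have m: "reachable \<theta> m u" "reachable \<theta> m [a]" for a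
    unfolding m_def using reachable_add[OF rs l, of k] reachable_add[OF rs k, of l a]
    by (simp_all add: add.commute)
  obtain cs :: "'a list" where cs: "set cs = UNIV"
    using finite_list[OF finite] by blast
  define ts where "ts = u # map (\<lambda>c. [c]) cs"
  \<comment> \<open>One letter of \<open>v\<close> is reserved for each word of \<open>ts\<close>,
    and two more for the ends \<open>c\<close> and \<open>d\<close>, whose images make
    \<open>x\<close> and \<open>z\<close> non-empty.\<close>
  obtain v where v: "legal \<theta> v" "length v = Suc (length ts) + 1"
    using long by blast
  obtain c v' where "v = c # v'" "length v' = Suc (length ts)"
    using v(2) by (cases v) auto
  then obtain d v'' where v'': "v = [c] @ v'' @ [d]" "length v'' = length ts"
    by (cases v' rule: rev_cases) auto
  obtain j where j: "reachable \<theta> j v"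
    using legal_imp_reachable[OF rs prim v(1)] by blast
  have "\<exists>x y z. x @ y @ z \<in> realisations_pow \<theta> (j + m) [b] \<and> x \<noteq> [] \<and> z \<noteq> [] \<and>
    set y = UNIV \<and> sublist u y" for b
  proof -
    obtain w p s where w: "w \<in> realisations_pow \<theta> j [b]" "w = p @ v @ s"
      using j unfolding reachable_def sublist_def by blast
    obtain x where x: "x \<in> realisations_pow \<theta> m (p @ [c])"
      using realisations_pow_nonempty[OF rs] by blast
    obtain z where z: "z \<in> realisations_pow \<theta> m (d # s)"
      using realisations_pow_nonempty[OF rs] by blast
    have "reachable \<theta> m t" if "t \<in> set ts" for t
      using that m by (auto simp: ts_def)
    then obtain y where y: "y \<in> realisations_pow \<theta> m v''" "\<forall>t\<in>set ts. sublist t y"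
      using reachable_simultaneously[OF rs, of ts m v''] v''(2) by auto
    have "x @ y @ z \<in> realisations_pow \<theta> m ((p @ [c]) @ v'' @ (d # s))"
      using x y z by (intro realisations_pow_append)
    then have "x @ y @ z \<in> realisations_pow \<theta> (j + m) [b]"
      using realisations_pow_add[OF w(1)] by (simp add: w(2) v''(1))
    moreover have "x \<noteq> []" "z \<noteq> []"
      using x z Nil_in_realisations_powD[OF rs] by blast+
    moreover have "sublist u y" "\<And>a. a \<in> set y"
      using y(2) cs set_mono_sublist[of "[_]" y] by (auto simp: ts_def)
    ultimately show ?thesis by blast
  qed
  then show ?thesis by blast
qed

section \<open>Deterministic substitutions\<close>

definition subst :: "('a \<Rightarrow> 'a list) \<Rightarrow> 'a list \<Rightarrow> 'a list" where
  "subst \<sigma> u = concat (map \<sigma> u)"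

abbreviation subst_pow :: "('a \<Rightarrow> 'a list) \<Rightarrow> nat \<Rightarrow> 'a list \<Rightarrow> 'a list" where
  "subst_pow \<sigma> n \<equiv> subst \<sigma> ^^ n"

lemma subst_pow_Nil [simp]: "subst_pow \<sigma> n [] = []"
  by (induction n) (auto simp: subst_def)

lemma subst_pow_append: "subst_pow \<sigma> n (u @ v) = subst_pow \<sigma> n u @ subst_pow \<sigma> n v"
  by (induction n) (auto simp: subst_def)

lemma subst_pow_concat: "subst_pow \<sigma> n u = concat (map (\<lambda>b. subst_pow \<sigma> n [b]) u)"
proof (induction u)
  case (Cons b u)
  then show ?case
    using subst_pow_append[of n \<sigma> "[b]" u] by simp
qed simp

lemma subst_pow_add: "subst_pow \<sigma> (m + n) u = subst_pow \<sigma> m (subst_pow \<sigma> n u)"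
  by (simp add: funpow_add)

text \<open>Applying \<open>\<sigma>\<close> first displays the next iterate as a product of
  level-\<open>n\<close> blocks, one for each letter of \<open>\<sigma> b\<close>.\<close>

lemma subst_pow_Suc_single: "subst_pow \<sigma> (Suc n) [b] = subst_pow \<sigma> n (\<sigma> b)"
  by (simp add: funpow_Suc_right subst_def del: funpow.simps)

lemma subst_pow_sublist: "sublist u v \<Longrightarrow> sublist (subst_pow \<sigma> n u) (subst_pow \<sigma> n v)"
proof -
  assume "sublist u v"
  then obtain p s where "v = p @ u @ s"
    by (auto simp: sublist_def)
  then show ?thesis
    by (simp add: subst_pow_append)
qed

text \<open>The independent choices include replacing every occurrence of \<open>b\<close> by the
  same word \<open>\<sigma> b\<close>.\<close>

lemma subst_pow_in_realisations_pow:
  assumes "\<And>b. \<sigma> b \<in> realisations_pow \<theta> k [b]"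
  shows "subst_pow \<sigma> n u \<in> realisations_pow \<theta> (n * k) u"
proof (induction n)
  case (Suc n)
  have "subst \<sigma> v \<in> realisations_pow \<theta> k v" for v
  proof (induction v)
    case (Cons b v)
    then show ?case
      using realisations_pow_append[OF assms[of b] Cons.IH] by (simp add: subst_def)
  qed (simp add: subst_def realisations_pow_Nil)
  from realisations_pow_add[OF Suc this] show ?case
    by (simp add: add.commute)
qed simp

text \<open>If \<open>u\<close> met three consecutive blocks, it would contain the middle one and a
  letter on each side, hence be longer than that block.\<close>

lemma sublist_concat_short:
  assumes "sublist u (concat (map f xs))" "\<And>b. length u \<le> length (f b)"
  shows "\<exists>ys. sublist ys xs \<and> length ys \<le> 2 \<and> sublist u (concat (map f ys))"
  using assms(1)
proof (induction xs)
  case Nil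
  then show ?case by auto
next
  case (Cons x xs)
  then consider "sublist u (f x)" | "sublist u (concat (map f xs))"
    | u1 u2 where "u = u1 @ u2" "suffix u1 (f x)" "prefix u2 (concat (map f xs))"
    by (auto simp: sublist_append)
  then show ?case
  proof cases
    case 1
    then show ?thesis
      by (intro exI[of _ "[x]"]) (auto simp: prefix_imp_sublist)
  next
    case 2
    then obtain ys where "sublist ys xs" "length ys \<le> 2" "sublist u (concat (map f ys))"
      using Cons.IH by blast
    then show ?thesis
      by (meson sublist_Cons_right)
  next
    case 3
    show ?thesis
    proof (cases xs)
      case Nil
      then show ?thesis
        using Cons.prems by (intro exI[of _ "[x]"]) auto
    next
      case (Cons y ys)
      have "length u2 \<le> length (f y)"
        using assms(2)[of y] 3(1) by simp
      then have "prefix u2 (f y)"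
        using 3(3) Cons by (auto simp: prefix_append)
      then have "sublist u (f x @ f y)"
        using 3 by (auto simp: sublist_append)
      then show ?thesis
        using Cons by (intro exI[of _ "[x, y]"]) (auto simp: prefix_imp_sublist)
    qed
  qed
qed

text \<open>An occurrence of \<open>v\<close> that starts in a block spends at most \<open>M\<close>
  letters there; at least \<open>M\<close> remain, enough to cover the following block.\<close>

lemma block_sublist_long:
  assumes "sublist v (concat (map f xs))" "\<And>b. length (f b) \<le> M" "0 < M" "2 * M \<le> length v"
  shows "\<exists>b. sublist (f b) v"
  using assms(1)
proof (induction xs)
  case Nil
  then show ?case using assms by auto
next
  case (Cons x xs)
  then consider "sublist v (f x)" | "sublist v (concat (map f xs))"
    | v1 v2 where "v = v1 @ v2" "suffix v1 (f x)" "prefix v2 (concat (map f xs))"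
    by (auto simp: sublist_append)
  then show ?case
  proof cases
    case 1
    then show ?thesis
      using sublist_length_le[of v "f x"] assms(2)[of x] assms(3,4) by simp
  next
    case 2
    then show ?thesis by (rule Cons.IH)
  next
    case 3
    have long: "M \<le> length v2"
      using suffix_length_le[OF 3(2)] assms(2)[of x] assms(4) 3(1) by simp
    then obtain y ys where xs: "xs = y # ys"
      using 3(3) assms(3) by (cases xs) auto
    have "prefix (f y) v2"
      using 3(3) long assms(2)[of y] xs prefix_length_prefix[of "f y" "concat (map f xs)" v2] by simp
    then have "sublist (f y) v"
      by (simp add: 3(1) prefix_imp_sublist sublist_append)
    then show ?thesis by blast
  qed
qed

section \<open>Growth and linear repetitivity of deterministic substitutions\<close>

lemma length_subst_pow_ge:
  assumes "\<And>b. 2 \<le> length (\<sigma> b)"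
  shows "2 ^ n * length u \<le> length (subst_pow \<sigma> n u)"
proof (induction n)
  case (Suc n)
  have "2 * length v \<le> length (subst \<sigma> v)" for v
  proof (induction v)
    case (Cons b v)
    then show ?case using assms[of b] by (simp add: subst_def)
  qed simp
  from this[of "subst_pow \<sigma> n u"] Suc show ?case by simp
qed simp

text \<open>Every \<open>c\<close> occurs in \<open>\<sigma> b\<close>, so the
  level-\<open>n\<close> block of \<open>c\<close> lies in the next block of any \<open>b\<close>;
  the remaining \<open>j\<close> steps repeat this with \<open>b\<close> itself.\<close>

lemma subst_pow_sublist_later:
  assumes "\<And>b. set (\<sigma> b) = UNIV"
  shows "sublist (subst_pow \<sigma> n [c]) (subst_pow \<sigma> (n + Suc j) [b])"
proof -
  have step: "sublist (subst_pow \<sigma> n [c]) (subst_pow \<sigma> (Suc n) [b])" for n b c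
  proof -
    have "c \<in> set (\<sigma> b)"
      using assms by simp
    then have "sublist [c] (\<sigma> b)"
      by (metis append_Cons append_Nil sublist_appendI split_list)
    then show ?thesis
      unfolding subst_pow_Suc_single by (rule subst_pow_sublist)
  qed
  show ?thesis
  proof (induction j arbitrary: b)
    case 0
    then show ?case using step[of n c b] by simp
  next
    case (Suc j)
    from Suc[of b] step[of "n + Suc j" b b] show ?case
      using sublist_order.order.trans by simp
  qed
qed

text \<open>Block lengths at consecutive levels differ by bounded factors. A word \<open>u\<close>
  comparable to the level-\<open>n\<close> blocks lies in the image of at most two adjacent letters.
  These occur at level \<open>q\<close> of every letter, so every block of level
  \<open>Suc n + q\<close> contains \<open>u\<close>, and a \<open>v\<close> twice as long as such
  blocks contains one. The exponents \<open>N\<close> and \<open>N'\<close> differ because factors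
  of the limit sequence may come from different iterates.\<close>

lemma subst_pow_linearly_repetitive:
  fixes \<sigma> :: "'a::finite \<Rightarrow> 'a list"
  assumes all: "\<And>b. set (\<sigma> b) = UNIV" and two: "\<And>b. 2 \<le> length (\<sigma> b)"
  shows "\<exists>L::nat\<ge>1. \<forall>u v N N'. u \<noteq> [] \<longrightarrow> sublist u (subst_pow \<sigma> N [a]) \<longrightarrow>
    sublist v (subst_pow \<sigma> N' [a]) \<longrightarrow> L * length u \<le> length v \<longrightarrow> sublist u v"
proof -
  let ?S = "subst_pow \<sigma>"
  define M where "M n = Max (range (\<lambda>b. length (?S n [b])))" for n
  define R where "R = Max (range (\<lambda>b. length (\<sigma> b)))"
  have le_M: "length (?S n [b]) \<le> M n" for n b
    unfolding M_def by (intro Max_ge) auto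
  have le_R: "length (\<sigma> b) \<le> R" for b
    unfolding R_def by (intro Max_ge) auto
  have R1: "1 \<le> R"
    using le_R[of a] two[of a] by simp
  have M_ge: "2 ^ n \<le> M n" for n
    using length_subst_pow_ge[of \<sigma> n "[a]"] two le_M[of n a] by simp
  \<comment> \<open>Even the shortest block of level \<open>Suc n\<close> contains the longest one
    of level \<open>n\<close>.\<close>
  have M_le: "M n \<le> length (?S (Suc n) [b])" for n b
    unfolding M_def using subst_pow_sublist_later[OF all, where n = n and j = 0 and b = b]
    by (auto intro!: sublist_length_le)
  have length_le: "length (?S n w) \<le> M n * length w" for n w
  proof (induction w)
    case (Cons b w)
    then show ?case
      using subst_pow_append[of n \<sigma> "[b]" w] le_M[of n b] by simp
  qed simp
  have "length (?S (Suc n) [b]) \<le> M n * R" for n b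
    unfolding subst_pow_Suc_single
    using length_le[of n "\<sigma> b"] le_R[of b] by (meson mult_le_mono2 order_trans)
  then have M_Suc: "M (Suc n) \<le> M n * R" for n
    unfolding M_def[of "Suc n"] by auto
  have M_add: "M (n + j) \<le> M n * R ^ j" for n j
  proof (induction j)
    case (Suc j)
    have "M (n + Suc j) \<le> M (n + j) * R"
      using M_Suc[of "n + j"] by simp
    also have "\<dots> \<le> M n * R ^ j * R"
      using Suc by simp
    finally show ?case by (simp add: mult_ac)
  qed simp
  have later: "sublist t (?S (n + Suc j) [b])" if "sublist t (?S n [c])" for t n j b c
    using that subst_pow_sublist_later[OF all] by (rule sublist_order.order.trans)
  \<comment> \<open>These words of at most two letters are finite in number, so a single exponent
    can serve them all.\<close>
  define Y where "Y = {ys. length ys \<le> 2 \<and> (\<exists>n. sublist ys (?S n [a]))}"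
  have "finite Y"
    using finite_lists_length_le[of "UNIV :: 'a set" 2] by (rule finite_subset[rotated]) (auto simp: Y_def)
  have "\<forall>ys\<in>Y. \<exists>n. sublist ys (?S n [a])"
    unfolding Y_def by blast
  from bchoice[OF this] obtain g where g: "\<And>ys. ys \<in> Y \<Longrightarrow> sublist ys (?S (g ys) [a])"
    by blast
  \<comment> \<open>\<open>Suc\<close> makes \<open>q\<close> strictly larger than every
    \<open>g ys\<close>: \<open>later\<close> needs at least one further step to pass from
    \<open>a\<close> to an arbitrary \<open>b\<close>.\<close>
  define q where "q = Suc (Max (g ` Y))"
  have q: "sublist ys (?S q [b])" if "ys \<in> Y" for ys b
  proof -
    have "g ys < q"
      unfolding q_def using that \<open>finite Y\<close> by (simp add: le_imp_less_Suc)
    then obtain j where "q = g ys + Suc j"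
      using less_iff_Suc_add by auto
    then show ?thesis
      using later[OF g[OF that]] by simp
  qed
  \<comment> \<open>Twice the blocks of level \<open>Suc n + q\<close>: these have length at most
    \<open>M n * R ^ Suc q\<close>, and \<open>M n \<le> length u * R\<close> brings in the last
    factor \<open>R\<close>.\<close>
  define L where "L = 2 * R ^ (q + 2)"
  have "sublist u v"
    if u: "u \<noteq> []" "sublist u (?S N [a])" and v: "sublist v (?S N' [a])" "L * length u \<le> length v"
    for u v N N'
  proof -
    \<comment> \<open>Minimality of \<open>n\<close> gives the reverse estimate \<open>Mn\<close>,
      so the blocks of this level are not much longer than \<open>u\<close>.\<close>
    define n where "n = (LEAST n. length u \<le> M n)"
    have "length u \<le> M (length u)"
      using M_ge[of "length u"] less_exp[of "length u"] by linarith
    then have un: "length u \<le> M n"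
      unfolding n_def by (rule LeastI)
    have Mn: "M n \<le> length u * R"
    proof (cases n)
      case 0
      have "M 0 = 1"
        by (simp add: M_def)
      then show ?thesis
        using 0 u(1) R1 mult_le_mono[of 1 "length u" 1 R] by (simp add: Suc_leI)
    next
      case (Suc n')
      then have "M n' < length u"
        using not_less_Least[of n' "\<lambda>n. length u \<le> M n"] by (simp add: n_def)
      then show ?thesis
        using M_Suc[of n'] Suc by (meson less_imp_le mult_le_mono1 order_trans)
    qed
    \<comment> \<open>Passing to a later iterate lets \<open>u\<close> be read in a product of
      blocks of level \<open>Suc n\<close>, all at least as long as \<open>u\<close>.\<close>
    have "sublist u (?S (N + Suc n) [a])"
      using u(2) by (rule later)
    then have "sublist u (concat (map (\<lambda>b. ?S (Suc n) [b]) (?S N [a])))"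
      by (simp only: add.commute[of N] subst_pow_add subst_pow_concat[where n = "Suc n" and u = "?S N [a]"])
    from sublist_concat_short[OF this order_trans[OF un M_le]]
    obtain ys where ys: "sublist ys (?S N [a])" "length ys \<le> 2"
      "sublist u (?S (Suc n) ys)"
      unfolding subst_pow_concat[symmetric] by blast
    have u': "sublist u (?S (Suc n + q) [b])" for b
    proof -
      have "sublist ys (?S q [b])"
        using q ys by (auto simp: Y_def)
      from subst_pow_sublist[OF this, of "Suc n" \<sigma>] ys(3) show ?thesis
        unfolding subst_pow_add by (rule sublist_order.order.trans[rotated])
    qed
    have "M (Suc n + q) \<le> M n * R ^ (Suc q)"
      using M_add[of n "Suc q"] by simp
    also have "\<dots> \<le> length u * R * R ^ (Suc q)"
      using Mn by (rule mult_le_mono1)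
    finally have "2 * M (Suc n + q) \<le> length v"
      using v(2) by (simp add: L_def mult_ac)
    moreover have "sublist v (?S (N' + Suc (n + q)) [a])"
      using v(1) by (rule later)
    then have "sublist v (concat (map (\<lambda>b. ?S (Suc n + q) [b]) (?S N' [a])))"
      by (simp only: add.commute[of N'] add_Suc[symmetric] subst_pow_add[where m = "Suc n + q"]
          subst_pow_concat[where n = "Suc n + q" and u = "?S N' [a]"])
    moreover have "0 < M (Suc n + q)"
      using M_ge[of "Suc n + q"] by (rule less_le_trans[rotated]) simp
    ultimately obtain b where "sublist (?S (Suc n + q) [b]) v"
      using block_sublist_long[of v "\<lambda>b. ?S (Suc n + q) [b]" _ "M (Suc n + q)"] le_M by blast
    then show ?thesis
      using u' sublist_order.order.trans by blast
  qed
  moreover have "1 \<le> L"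
    using R1 by (simp add: L_def Suc_leI)
  ultimately show ?thesis by blast
qed

section \<open>Bi-infinite sequences\<close>

lemma subword_of_seq_iff_nth:
  "subword_of_seq u w \<longleftrightarrow> (\<exists>i. \<forall>j<length u. u ! j = w (i + int j))"
proof -
  have "u = map (\<lambda>j. w (i + int j)) [0..<length u] \<longleftrightarrow> (\<forall>j<length u. u ! j = w (i + int j))" for i
    unfolding list_eq_iff_nth_eq by simp
  then show ?thesis
    unfolding subword_of_seq_def by blast
qed

text \<open>Non-empty \<open>A n\<close> and \<open>B n\<close> push both ends of \<open>W n\<close>
  outwards without bound, so the nested words exhaust a sequence indexed by all integers.\<close>

lemma nested_words_limit:
  fixes W :: "nat \<Rightarrow> 'a list"
  assumes W: "\<And>n. W (Suc n) = A n @ W n @ B n" and "\<And>n. A n \<noteq> []" "\<And>n. B n \<noteq> []"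
  shows "\<exists>w. \<forall>u. subword_of_seq u w \<longleftrightarrow> (\<exists>n. sublist u (W n))"
proof -
  \<comment> \<open>\<open>p n\<close> is the offset of coordinate 0 in \<open>W n\<close>: every
    \<open>A i\<close> put in front moves it to the right. \<open>valid\<close> then tells which
    coordinates \<open>W n\<close> covers.\<close>
  define p where "p n = (\<Sum>i<n. int (length (A i)))" for n
  define valid where "valid n i \<longleftrightarrow> 0 \<le> i + p n \<and> i + p n < int (length (W n))" for n i
  \<comment> \<open>By \<open>lens\<close>, level \<open>Suc (nat \<bar>i\<bar>)\<close> covers
    coordinate \<open>i\<close>; by \<open>same\<close>, every other covering level gives the same
    letter.\<close>
  define w where "w i = W (Suc (nat \<bar>i\<bar>)) ! nat (i + p (Suc (nat \<bar>i\<bar>)))" for i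
  have p_Suc: "p (Suc n) = p n + int (length (A n))" for n
    by (simp add: p_def)
  have lens: "int n \<le> p n \<and> p n + int n \<le> int (length (W n))" for n
  proof (induction n)
    case (Suc n)
    have "1 \<le> length (A n)" "1 \<le> length (B n)"
      using assms(2,3) by (simp_all add: Suc_leI)
    then show ?case
      using Suc by (simp add: W p_Suc)
  qed (simp add: p_def)
  have valid: "valid n i" if "\<bar>i\<bar> < int n" for n i
    using lens[of n] that unfolding valid_def by linarith
  have same: "valid (n + k) i \<and> W (n + k) ! nat (i + p (n + k)) = W n ! nat (i + p n)"
    if "valid n i" for n k i
  proof (induction k)
    case (Suc k)
    have bounds: "0 \<le> i + p (n + k)" "nat (i + p (n + k)) < length (W (n + k))"
      using Suc by (simp_all add: valid_def nat_less_iff)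
    then have "nat (i + p (n + Suc k)) = length (A (n + k)) + nat (i + p (n + k))"
      unfolding add_Suc_right p_Suc by linarith
    then show ?case
      using Suc bounds by (simp add: valid_def W p_Suc nth_append)
  qed (use that in simp)
  have w: "w i = W n ! nat (i + p n)" if "valid n i" for n i
  proof -
    have "valid (Suc (nat \<bar>i\<bar>)) i"
      by (rule valid) simp
    from same[OF this, of n] same[OF that, of "Suc (nat \<bar>i\<bar>)"] show ?thesis
      by (simp add: w_def add.commute)
  qed
  have "subword_of_seq u w \<longleftrightarrow> (\<exists>n. sublist u (W n))" for u
  proof
    assume "subword_of_seq u w"
    then obtain i where i: "\<And>j. j < length u \<Longrightarrow> u ! j = w (i + int j)"
      by (auto simp: subword_of_seq_iff_nth)
    \<comment> \<open>This level covers both \<open>i\<close> and \<open>i + length u\<close>, hence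
      the whole occurrence of \<open>u\<close>.\<close>
    define n where "n = Suc (nat \<bar>i\<bar> + length u)"
    have bounds: "0 \<le> i + p n" "i + int (length u) + p n < int (length (W n))"
      using valid[of i n] valid[of "i + int (length u)" n] by (auto simp: n_def valid_def)
    have "u = take (length u) (drop (nat (i + p n)) (W n))"
    proof (rule nth_equalityI)
      show "length u = length (take (length u) (drop (nat (i + p n)) (W n)))"
        using bounds by simp
      fix j assume j: "j < length u"
      have "u ! j = W n ! nat (i + int j + p n)"
        using i[OF j] w[OF valid, of "i + int j" n] j by (simp add: n_def)
      also have "nat (i + int j + p n) = nat (i + p n) + j"
        using bounds by simp
      finally show "u ! j = take (length u) (drop (nat (i + p n)) (W n)) ! j"
        using j bounds by simp
    qed
    then have "sublist u (W n)"
      by (metis sublist_drop sublist_order.order.trans sublist_take)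
    then show "\<exists>n. sublist u (W n)" ..
  next
    assume "\<exists>n. sublist u (W n)"
    then obtain n x y where n: "W n = x @ u @ y"
      by (auto simp: sublist_def)
    have "u ! j = w (int (length x) - p n + int j)" if "j < length u" for j
    proof -
      have "valid n (int (length x) - p n + int j)"
        using that n by (simp add: valid_def)
      from w[OF this] show ?thesis
        using that n by (simp add: nth_append nat_add_distrib)
    qed
    then show "subword_of_seq u w"
      unfolding subword_of_seq_iff_nth by blast
  qed
  then show ?thesis by blast
qed

lemma subword_of_seq_shift: "subword_of_seq u (\<lambda>i. w (i + s)) \<longleftrightarrow> subword_of_seq u w"
proof -
  have "(\<exists>i. \<forall>j<length u. u ! j = w (i + int j))"
    if "\<forall>j<length u. u ! j = w (i + int j + s)" for i
    using that by (intro exI[of _ "i + s"]) (simp add: algebra_simps)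
  moreover have "(\<exists>i. \<forall>j<length u. u ! j = w (i + int j + s))"
    if "\<forall>j<length u. u ! j = w (i + int j)" for i
    using that by (intro exI[of _ "i - s"]) (simp add: algebra_simps)
  ultimately show ?thesis
    unfolding subword_of_seq_iff_nth by blast
qed

text \<open>Membership in the subshift and linear repetitivity depend only on the set of subwords,
  which a shift leaves unchanged.\<close>

lemma Lin_RS_subshift_shift:
  "w \<in> Lin (RS_subshift \<theta>) \<Longrightarrow> (\<lambda>i. w (i + s)) \<in> Lin (RS_subshift \<theta>)"
  unfolding Lin_def RS_subshift_def linearly_repetitive_def mem_Collect_eq
    subword_of_seq_shift[of _ w s] .

text \<open>The hypothesis \<open>long\<close> excludes cases such as a one-letter alphabet with the
  letter as its own only image, where the subshift is empty.\<close>

lemma legal_subword_of_Lin: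
  fixes \<theta> :: "'a::finite \<Rightarrow> 'a list set"
  assumes rs: "random_substitution \<theta>" and prim: "primitive \<theta>" and u: "legal \<theta> u"
    and long: "\<And>n. \<exists>v. legal \<theta> v \<and> length v = n + 1"
  shows "\<exists>w\<in>Lin (RS_subshift \<theta>). subword_of_seq u w"
proof -
  obtain k where "\<forall>b. \<exists>x y z. x @ y @ z \<in> realisations_pow \<theta> k [b] \<and> x \<noteq> [] \<and> z \<noteq> [] \<and>
    set y = UNIV \<and> sublist u y"
    using realisation_with_all_letters[OF assms] by blast
  then obtain x y z where xyz: "\<And>b. x b @ y b @ z b \<in> realisations_pow \<theta> k [b]"
    "\<And>b. x b \<noteq> []" "\<And>b. z b \<noteq> []" "\<And>b. set (y b) = UNIV" "\<And>b. sublist u (y b)"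
    by metis
  define \<sigma> where "\<sigma> b = x b @ y b @ z b" for b
  have all: "set (\<sigma> b) = UNIV" for b
    using xyz(4) by (auto simp: \<sigma>_def)
  have "1 \<le> length (x b)" "1 \<le> length (z b)" for b
    using xyz(2,3) by (simp_all add: Suc_leI)
  then have two: "2 \<le> length (\<sigma> b)" for b
    unfolding \<sigma>_def length_append by (metis add_mono le_add2 one_add_one order_trans)
  fix a :: 'a
  \<comment> \<open>The seed \<open>a\<close> recurs inside \<open>\<sigma> a\<close> with non-empty
    words on both sides, which nests the iterates and makes them grow in both directions.\<close>
  obtain y1 y2 where "y a = y1 @ a # y2"
    using xyz(4)[of a] split_list[of a "y a"] by auto
  then have \<sigma>a: "\<sigma> a = (x a @ y1) @ [a] @ (y2 @ z a)"
    by (simp add: \<sigma>_def)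
  have ne: "subst_pow \<sigma> n v \<noteq> []" if "v \<noteq> []" for n v
    using length_subst_pow_ge[of \<sigma> n v] two that by auto
  have "\<exists>w. \<forall>t. subword_of_seq t w \<longleftrightarrow> (\<exists>n. sublist t (subst_pow \<sigma> n [a]))"
  proof (rule nested_words_limit)
    show "subst_pow \<sigma> (Suc n) [a] =
      subst_pow \<sigma> n (x a @ y1) @ subst_pow \<sigma> n [a] @ subst_pow \<sigma> n (y2 @ z a)" for n
      unfolding subst_pow_Suc_single by (subst \<sigma>a) (simp only: subst_pow_append)
  qed (use ne xyz(2,3) in auto)
  then obtain w where w: "\<And>t. subword_of_seq t w \<longleftrightarrow> (\<exists>n. sublist t (subst_pow \<sigma> n [a]))"
    by blast
  \<comment> \<open>The \<open>n\<close>-th iterate is a realisation of level \<open>n * k\<close>,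
    so its factors are legal.\<close>
  have "w \<in> RS_subshift \<theta>"
    unfolding RS_subshift_def legal_def mem_Collect_eq w
    using subst_pow_in_realisations_pow[of \<sigma> \<theta> k] xyz(1)[folded \<sigma>_def] by blast
  moreover have "linearly_repetitive w"
  proof -
    obtain L where L: "1 \<le> L" "\<And>u v N N'. u \<noteq> [] \<Longrightarrow> sublist u (subst_pow \<sigma> N [a]) \<Longrightarrow>
      sublist v (subst_pow \<sigma> N' [a]) \<Longrightarrow> L * length u \<le> length v \<Longrightarrow> sublist u v"
      using subst_pow_linearly_repetitive[of \<sigma> a] all two by blast
    have "sublist u v" if "1 \<le> length u" "subword_of_seq u w" "subword_of_seq v w"
      "real L * real (length u) \<le> real (length v)" for u v
      using that L(2)[of u _ v] unfolding w of_nat_mult[symmetric] of_nat_le_iff by auto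
    then show ?thesis
      unfolding linearly_repetitive_def using L(1) by (intro exI[of _ "real L"]) auto
  qed
  moreover have "subword_of_seq u w"
    unfolding w using xyz(5)[of a]
    by (intro exI[of _ 1]) (simp add: subst_def \<sigma>_def sublist_append)
  ultimately show ?thesis
    by (auto simp: Lin_def)
qed

section \<open>Density in the subshift\<close>

lemma subword_of_seq_window: "subword_of_seq (map (\<lambda>j. w (i + int j)) [0..<n]) w"
  unfolding subword_of_seq_def by (intro exI[of _ i]) simp

theorem proposition16:
  fixes \<theta> :: "'a::finite \<Rightarrow> 'a list set"
  assumes "random_substitution \<theta>"
    and "primitive \<theta>"
  shows "subtopology full_shift (RS_subshift \<theta>) closure_of Lin (RS_subshift \<theta>) = RS_subshift \<theta>"
proof -
  let ?X = "RS_subshift \<theta>"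
  have sub: "Lin ?X \<subseteq> ?X"
    by (auto simp: Lin_def)
  have top: "topspace full_shift = UNIV"
    by (simp add: full_shift_def)
  \<comment> \<open>As \<open>Lin ?X\<close> lies in \<open>?X\<close>, its closure in the subspace
    is its closure in the full shift cut down to \<open>?X\<close>.\<close>
  have "w \<in> full_shift closure_of Lin ?X" if w: "w \<in> ?X" for w
    unfolding in_closure_of top
  proof (intro conjI allI impI UNIV_I)
    fix T assume T: "w \<in> T \<and> openin full_shift T"
    then obtain U where U: "finite {i. U i \<noteq> UNIV}" "w \<in> Pi\<^sub>E UNIV U" "Pi\<^sub>E UNIV U \<subseteq> T"
      unfolding full_shift_def openin_product_topology_alt by auto
    \<comment> \<open>The basic box restricts finitely many coordinates, so agreement with
      \<open>w\<close> from \<open>-N\<close> to \<open>N\<close> ensures membership in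
      \<open>T\<close>.\<close>
    obtain N where N: "\<And>i. U i \<noteq> UNIV \<Longrightarrow> \<bar>i\<bar> \<le> int N"
    proof -
      have le: "\<bar>i\<bar> \<le> Max (abs ` {i. U i \<noteq> UNIV})" if "U i \<noteq> UNIV" for i
        using that U(1) by (intro Max_ge) auto
      have "\<bar>i\<bar> \<le> int (nat (Max (abs ` {i. U i \<noteq> UNIV})))" if "U i \<noteq> UNIV" for i
        using le[OF that] by linarith
      then show ?thesis using that by blast
    qed
    have window: "legal \<theta> (map (\<lambda>j. w (i + int j)) [0..<n])" if "n \<noteq> 0" for i n
      using w that subword_of_seq_window[of w i n] by (simp add: RS_subshift_def)
    define u where "u = map (\<lambda>j. w (- int N + int j)) [0..<2 * N + 1]"
    have "legal \<theta> u"
      unfolding u_def by (rule window) simp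
    \<comment> \<open>The point \<open>w\<close> itself supplies legal words of every length; for an
      empty subshift there is nothing to approximate.\<close>
    moreover have "\<exists>v. legal \<theta> v \<and> length v = n + 1" for n
      using window[of "n + 1" 0] by (intro exI[of _ "map (\<lambda>j. w (0 + int j)) [0..<n + 1]"]) simp
    ultimately obtain x where x: "x \<in> Lin ?X" "subword_of_seq u x"
      using legal_subword_of_Lin[OF assms] by blast
    obtain i where i: "\<And>j. j < length u \<Longrightarrow> u ! j = x (i + int j)"
      using x(2) by (auto simp: subword_of_seq_iff_nth)
    \<comment> \<open>The shift moves the occurrence of \<open>u\<close> from position
      \<open>i\<close> to \<open>-N\<close>, where \<open>u\<close> was cut from
      \<open>w\<close>.\<close>
    define y where "y j = x (j + (i + int N))" for j
    have "y \<in> Lin ?X"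
      unfolding y_def using x(1) by (rule Lin_RS_subshift_shift)
    moreover have "y j = w j" if "\<bar>j\<bar> \<le> int N" for j
    proof -
      have "nat (j + int N) < length u"
        using that by (simp add: u_def)
      moreover have "int (nat (j + int N)) = j + int N"
        using that by simp
      ultimately show ?thesis
        using i[of "nat (j + int N)"] by (simp add: u_def y_def ac_simps del: upt_Suc int_nat_eq)
    qed
    then have "y j \<in> U j" for j
      using N[of j] U(2) by (cases "U j = UNIV") (auto simp: PiE_iff)
    then have "y \<in> T"
      using U(3) by auto
    ultimately show "\<exists>y. y \<in> Lin ?X \<and> y \<in> T" by blast
  qed
  then show ?thesis
    using sub by (auto simp: closure_of_subtopology Int_absorb1)
qed

end
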